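(* For every separable metric space $X$ and every $E\subseteq X$, $$\dim_{\mathsf H}E=\inf\{\beta>0: E\text{ is }\overline{\mathfrak h^{1/\beta}}\text{-dominated}\}.$$
   Context: $\mathbb S$ is the set of all strictly decreasing sequences $s=(s_n)_{n\geq1}$ of positive reals converging to $0$. For $s\in\mathbb S$ and $k\geq1$ let $s^{\times k}=(s_{kn})_{n\geq1}$, and let $\overline s=\{s^{\times k}:k\geq1\}$. For $S\subseteq\mathbb S$, a set $E\subseteq X$ is $S$-dominated if for each $s\in S$ there is a sequence $(E_n)_{n\geq1}$ of subsets of $X$ that covers $E$ and satisfies $\operatorname{diam}E_n<s_n$ for all $n$. For $q>0$, $\mathfrak h^q$ is the sequence $\bigl((n+1)^{-q}\bigr)_{n\geq1}$. $\dim_{\mathsf H}$ denotes Hausdorff dimension, $\dim_{\mathsf H}E=\inf\{\beta>0:\mathscr H^\beta(E)=0\}$ with $\mathscr H^\beta$ the $\beta$-dimensional Hausdorff measure; the infimum of the empty set is $\infty$. *)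

theory Defs
  imports "HOL-Analysis.Analysis"
begin

(* Sequences (s_n)_{n >= 1} are functions on nat that are only inspected at arguments >= 1;
   the value at 0 is irrelevant. *)

definition null_seqs :: "(nat \<Rightarrow> real) set"
  where "null_seqs = {s. strict_antimono_on {1..} s \<and> (\<forall>n\<ge>1. s n > 0) \<and> s \<longlonglongrightarrow> 0}"

definition dilate :: "(nat \<Rightarrow> real) \<Rightarrow> nat \<Rightarrow> nat \<Rightarrow> real"
  where "dilate s k = (\<lambda>n. s (k * n))"

definition dilates :: "(nat \<Rightarrow> real) \<Rightarrow> (nat \<Rightarrow> real) set"
  where "dilates s = {dilate s k | k. k \<ge> 1}"

definition hseq :: "real \<Rightarrow> nat \<Rightarrow> real"
  where "hseq q = (\<lambda>n. (real n + 1) powr (- q))"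

lemma dilate_in_null_seqs:
  assumes "s \<in> null_seqs" "k \<ge> 1"
  shows "dilate s k \<in> null_seqs"
proof -
  have "strict_mono (\<lambda>n. k * n)"
    using assms(2) by (auto simp: strict_mono_def)
  moreover have "s \<longlonglongrightarrow> 0"
    using assms(1) by (simp add: null_seqs_def)
  ultimately have "dilate s k \<longlonglongrightarrow> 0"
    using LIMSEQ_subseq_LIMSEQ[of s 0 "\<lambda>n. k * n"] by (simp add: dilate_def o_def)
  then show ?thesis
    using assms by (auto simp: null_seqs_def dilate_def monotone_on_def Suc_le_eq)
qed

lemma dilates_subset_null_seqs: "s \<in> null_seqs \<Longrightarrow> dilates s \<subseteq> null_seqs"
  by (auto simp: dilates_def dilate_in_null_seqs)

lemma hseq_in_null_seqs:
  assumes "q > 0"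
  shows "hseq q \<in> null_seqs"
proof -
  have "filterlim (\<lambda>n. real n + 1) at_top sequentially"
    using filterlim_tendsto_add_at_top[OF tendsto_const filterlim_real_sequentially, of 1]
    by (simp add: add.commute)
  then have "hseq q \<longlonglongrightarrow> 0"
    unfolding hseq_def using assms by (intro tendsto_neg_powr) auto
  moreover have "(real m + 1) powr (- q) < (real n + 1) powr (- q)" if "n < m" for m n
    using that assms by (intro powr_less_mono2_neg) auto
  ultimately show ?thesis
    by (auto simp: null_seqs_def hseq_def monotone_on_def)
qed

(* Diameter with values in [0, \<infinity>]; the library's real-valued "diameter" has an unspecified
   value on unbounded sets. The empty set has diameter 0. *)
definition ediam :: "('a \<Rightarrow> 'a \<Rightarrow> real) \<Rightarrow> 'a set \<Rightarrow> ennreal"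
  where "ediam d A = (SUP x\<in>A. SUP y\<in>A. ennreal (d x y))"

definition dominated ::
    "'a set \<Rightarrow> ('a \<Rightarrow> 'a \<Rightarrow> real) \<Rightarrow> (nat \<Rightarrow> real) set \<Rightarrow> 'a set \<Rightarrow> bool"
  where "dominated X d S E \<longleftrightarrow>
    (\<forall>s\<in>S. \<exists>A :: nat \<Rightarrow> 'a set.
       (\<forall>n\<ge>1. A n \<subseteq> X) \<and> E \<subseteq> (\<Union>n\<in>{1..}. A n) \<and> (\<forall>n\<ge>1. ediam d (A n) < ennreal (s n)))"

(* Used for b > 0. Covers of E by countably many sets of diameter at most \<delta>, so enn2real is
   applied to finite values only; finite covers are padded with empty sets, which
   contribute 0 powr b = 0. *)
definition hausdorff_premeasure ::
    "'a set \<Rightarrow> ('a \<Rightarrow> 'a \<Rightarrow> real) \<Rightarrow> real \<Rightarrow> real \<Rightarrow> 'a set \<Rightarrow> ennreal"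
  where "hausdorff_premeasure X d b \<delta> E =
    Inf {(\<Sum>n. ennreal (enn2real (ediam d (A n)) powr b)) | A :: nat \<Rightarrow> 'a set.
           (\<forall>n. A n \<subseteq> X \<and> ediam d (A n) \<le> ennreal \<delta>) \<and> E \<subseteq> (\<Union>n. A n)}"

(* The premeasure is antitone in \<delta>, so its limit as \<delta> tends to 0 is a supremum. *)
definition hausdorff_measure ::
    "'a set \<Rightarrow> ('a \<Rightarrow> 'a \<Rightarrow> real) \<Rightarrow> real \<Rightarrow> 'a set \<Rightarrow> ennreal"
  where "hausdorff_measure X d b E = (SUP \<delta>\<in>{0<..}. hausdorff_premeasure X d b \<delta> E)"

(* In ennreal, Inf {} = \<infinity>. *)
definition hausdorff_dim :: "'a set \<Rightarrow> ('a \<Rightarrow> 'a \<Rightarrow> real) \<Rightarrow> 'a set \<Rightarrow> ennreal"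
  where "hausdorff_dim X d E = (INF b\<in>{b. b > 0 \<and> hausdorff_measure X d b E = 0}. ennreal b)"

end

theory Submission
  imports Defs
begin

text \<open>
  Each side of the equation is an infimum over a set of exponents, and the two sets agree up to
  arbitrarily small increases of the exponent.

  If the \<open>b\<close>-dimensional measure of \<open>E\<close> vanishes, then \<open>E\<close> has covers whose total \<open>b\<close>-weight, the
  sum of the \<open>b\<close>-th powers of the diameters, is as small as desired.  Listing a cover by
  decreasing weight, the \<open>n\<close>-th set carries at most an \<open>n\<close>-th of the total, so a total below
  \<open>1 / (k + 1)\<close> leaves it a diameter below \<open>(k n + 1) powr (- 1 / b)\<close>.  Hence \<open>b\<close> itself belongs to
  the set on the right (\<open>dominated_if_hausdorff_measure_zero\<close>, by \<open>ex_inj_rank\<close>).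

  Conversely, a cover subordinate to the \<open>k\<close>-th dilate for the exponent \<open>\<beta>\<close> has, for \<open>\<gamma> > \<beta>\<close>, a
  total \<open>\<gamma>\<close>-weight of at most \<open>k powr (- \<gamma> / \<beta>)\<close> times the convergent series of
  \<open>n powr (- \<gamma> / \<beta>)\<close>.  This tends to zero as \<open>k\<close> grows, and so do the diameters, so every
  \<open>\<gamma> > \<beta>\<close> belongs to the set on the left (\<open>hausdorff_measure_zero_if_dominated\<close>).
\<close>

text \<open>
  Rank the terms by decreasing size, ties broken by the index: a term of rank \<open>r\<close> is the smallest
  of \<open>r\<close> terms, so \<open>r\<close> times its size is at most the whole sum.  Positivity makes all ranks finite.
  Injectivity is all that a re-indexing of covers needs: an index that is no rank gets the empty
  set.
\<close>
lemma ex_inj_rank: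
  fixes w :: "nat \<Rightarrow> real"
  assumes pos: "\<And>i. w i > 0" and sm: "summable w"
  obtains r :: "nat \<Rightarrow> nat"
  where "inj r" "\<And>i. r i \<ge> 1" "\<And>i. real (r i) * w i \<le> suminf w"
proof -
  define S where "S = (\<lambda>i. {j. w j > w i \<or> (w j = w i \<and> j \<le> i)})"
  have fin: "finite (S i)" for i
  proof -
    have "w \<longlonglongrightarrow> 0"
      using sm by (rule summable_LIMSEQ_zero)
    then have "eventually (\<lambda>j. w j < w i) sequentially"
      using pos[of i] by (rule order_tendstoD)
    then obtain N where "\<And>j. j \<ge> N \<Longrightarrow> w j < w i"
      by (auto simp: eventually_sequentially)
    then have "S i \<subseteq> {..<N}"
      unfolding S_def by (force simp: not_le[symmetric])
    then show ?thesis
      by (rule finite_subset) simp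
  qed
  have self: "i \<in> S i" for i
    by (simp add: S_def)
  have neq: "card (S i) \<noteq> card (S j)" if "w j < w i \<or> (w j = w i \<and> i < j)" for i j
  proof -
    have "S i \<subseteq> S j" "j \<notin> S i"
      using that by (auto simp: S_def)
    then have "S i \<subset> S j"
      using self[of j] by blast
    then show ?thesis
      using psubset_card_mono[OF fin] by (metis less_irrefl)
  qed
  have "inj (\<lambda>i. card (S i))"
  proof (rule injI)
    fix i j assume "card (S i) = card (S j)"
    then show "i = j"
      using neq[of i j] neq[of j i] linorder_less_linear[of "w i" "w j"]
        linorder_less_linear[of i j] by metis
  qed
  moreover have "card (S i) \<ge> 1" for i
    using fin[of i] self[of i] by (metis One_nat_def Suc_leI card_gt_0_iff empty_iff)
  moreover have "real (card (S i)) * w i \<le> suminf w" for i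
  proof -
    have "real (card (S i)) * w i = (\<Sum>j\<in>S i. w i)"
      by simp
    also have "\<dots> \<le> (\<Sum>j\<in>S i. w j)"
      by (rule sum_mono) (auto simp: S_def)
    also have "\<dots> \<le> suminf w"
      using sm fin pos by (intro sum_le_suminf) (auto intro: less_imp_le)
    finally show ?thesis .
  qed
  ultimately show ?thesis
    by (rule that)
qed

lemma dominated_if_hausdorff_measure_zero:
  assumes b: "b > 0" and null: "hausdorff_measure X d b E = 0"
  shows "dominated X d (dilates (hseq (1 / b))) E"
  unfolding dominated_def
proof
  fix s assume "s \<in> dilates (hseq (1 / b))"
  then obtain k where k: "k \<ge> 1" and s: "s = dilate (hseq (1 / b)) k"
    by (auto simp: dilates_def)
  define c where "c = 1 / (4 * (real k + 1))"
  have c: "c > 0"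
    by (simp add: c_def)
  have "hausdorff_premeasure X d b 1 E \<le> hausdorff_measure X d b E"
    unfolding hausdorff_measure_def by (rule SUP_upper) simp
  then have "hausdorff_premeasure X d b 1 E < ennreal (2 * c)"
    using null c by simp
  then obtain A :: "nat \<Rightarrow> 'a set" where
    A: "\<And>n. A n \<subseteq> X" "\<And>n. ediam d (A n) \<le> ennreal 1" "E \<subseteq> (\<Union>n. A n)" and
    sumA: "(\<Sum>n. ennreal (enn2real (ediam d (A n)) powr b)) < ennreal (2 * c)"
    unfolding hausdorff_premeasure_def Inf_less_iff by auto
  define v where "v = (\<lambda>n. enn2real (ediam d (A n)) powr b)"
  have v0: "v n \<ge> 0" for n
    by (simp add: v_def)
  have sumv: "(\<Sum>n. ennreal (v n)) < ennreal (2 * c)"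
    using sumA by (simp add: v_def)
  have smv: "summable v"
    using sumv v0 by (intro summable_suminf_not_top) auto
  have "suminf v < 2 * c"
    using sumv v0 smv by (simp add: suminf_ennreal2 ennreal_less_iff suminf_nonneg)
  \<comment> \<open>A set of diameter zero could have infinite rank; the geometric summand makes all weights
    positive and adds only \<open>2 c\<close> to the total.\<close>
  define w where "w = (\<lambda>n. v n + c * (1 / 2) ^ n)"
  have geo: "(\<lambda>n. c * (1 / 2) ^ n) sums (c * 2)"
    using geometric_sums[of "1 / 2 :: real"] by (intro sums_mult) simp
  have w_sums: "w sums (suminf v + c * 2)"
    unfolding w_def by (intro sums_add summable_sums smv geo)
  have sumw: "suminf w < 1 / (real k + 1)"
  proof -
    have "suminf w = suminf v + c * 2"
      using w_sums by (rule sums_unique[symmetric])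
    also have "\<dots> < 4 * c"
      using \<open>suminf v < 2 * c\<close> by simp
    also have "\<dots> = 1 / (real k + 1)"
      unfolding c_def times_divide_eq_right mult_divide_mult_cancel_left_if by simp
    finally show ?thesis .
  qed
  have vw: "v n < w n" for n
    using c by (simp add: w_def)
  have "w n > 0" for n
    using v0[of n] vw[of n] by simp
  then obtain r :: "nat \<Rightarrow> nat" where
    r: "inj r" "\<And>i. r i \<ge> 1" "\<And>i. real (r i) * w i \<le> suminf w"
    using ex_inj_rank sums_summable[OF w_sums] by metis
  have diam: "ediam d (A i) < ennreal (s (r i))" for i
  proof -
    have r0: "real (r i) \<ge> 1"
      using r(2)[of i] by simp
    have "real (r i) * v i < 1 / (real k + 1)"
    proof -
      have "real (r i) * v i \<le> real (r i) * w i"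
        using vw[of i] by (intro mult_left_mono) auto
      then show ?thesis
        using r(3)[of i] sumw by linarith
    qed
    \<comment> \<open>A rank is at least 1, so \<open>k r + 1 \<le> (k + 1) r\<close>; this is where the total \<open>1 / (k + 1)\<close> comes
      from.\<close>
    then have "real (r i) * v i * (real k + 1) < 1"
      by (subst (asm) pos_less_divide_eq) auto
    then have "v i * (real (r i) * (real k + 1)) < 1"
      by (simp only: mult_ac)
    moreover have "v i * (real k * real (r i) + 1) \<le> v i * (real (r i) * (real k + 1))"
      using r0 v0[of i] by (intro mult_left_mono) (simp_all add: distrib_left mult.commute)
    moreover have "real k * real (r i) + 1 > 0"
      by (intro add_nonneg_pos) simp_all
    ultimately have "v i < 1 / (real k * real (r i) + 1)"
      by (simp only: pos_less_divide_eq)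
    then have "v i powr (1 / b) < (1 / (real k * real (r i) + 1)) powr (1 / b)"
      using v0[of i] b by (intro powr_less_mono2) auto
    then have "enn2real (ediam d (A i)) < s (r i)"
      using b by (simp add: v_def powr_powr s dilate_def hseq_def powr_minus_divide powr_divide)
    moreover have "ediam d (A i) < top"
      using A(2)[of i] by (simp add: order_le_less_trans)
    ultimately show ?thesis
      by (metis enn2real_nonneg ennreal_enn2real ennreal_less_iff)
  qed
  define B where "B = (\<lambda>n. if n \<in> range r then A (inv r n) else {})"
  have B_r: "B (r i) = A i" for i
    using r(1) by (simp add: B_def)
  have "B n \<subseteq> X" for n
    using A(1) by (auto simp: B_def)
  moreover have "E \<subseteq> (\<Union>n\<in>{1..}. B n)"
  proof
    fix x assume "x \<in> E"
    then obtain i where "x \<in> B (r i)"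
      using A(3) B_r by auto
    then show "x \<in> (\<Union>n\<in>{1..}. B n)"
      using r(2)[of i] by (intro UN_I[of "r i"]) simp_all
  qed
  moreover have "ediam d (B n) < ennreal (s n)" for n
  proof (cases "n \<in> range r")
    case True
    then show ?thesis
      using diam B_r by auto
  next
    case False
    then have "ediam d (B n) = 0"
      by (simp add: B_def ediam_def bot_ennreal)
    moreover have "s n > 0"
      by (simp add: s dilate_def hseq_def add_nonneg_pos flip: of_nat_mult)
    ultimately show ?thesis
      by simp
  qed
  ultimately show "\<exists>B. (\<forall>n\<ge>1. B n \<subseteq> X) \<and> E \<subseteq> (\<Union>n\<in>{1..}. B n) \<and>
      (\<forall>n\<ge>1. ediam d (B n) < ennreal (s n))"
    by blast
qed

text \<open>
  The passage from \<open>\<beta>\<close> to a larger \<open>\<gamma>\<close> makes the series of \<open>n powr (- \<gamma> / \<beta>)\<close> converge; at \<open>\<beta>\<close>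
  itself the bound would be the harmonic series.
\<close>
lemma hausdorff_measure_zero_if_dominated:
  assumes \<beta>: "\<beta> > 0" "\<beta> < \<gamma>" and dom: "dominated X d (dilates (hseq (1 / \<beta>))) E"
  shows "hausdorff_measure X d \<gamma> E = 0"
proof -
  define p where "p = \<gamma> / \<beta>"
  have p: "p > 1"
    using \<beta> by (simp add: p_def)
  define Z where "Z = (\<Sum>n. real (Suc n) powr (- p))"
  have smZ: "summable (\<lambda>n. real (Suc n) powr (- p))"
    using p by (subst summable_Suc_iff) (simp add: summable_real_powr_iff)
  have "hausdorff_premeasure X d \<gamma> \<delta> E \<le> 0 + ennreal \<epsilon>" if \<delta>: "\<delta> > 0" and \<epsilon>: "\<epsilon> > 0" for \<delta> \<epsilon>
  proof -
    have "(\<lambda>k. real k powr (- p) * Z) \<longlonglongrightarrow> 0 * Z"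
      using p by (intro tendsto_mult tendsto_neg_powr tendsto_const filterlim_real_sequentially) auto
    then have "eventually (\<lambda>k. real k powr (- p) * Z < \<epsilon>) sequentially"
      using \<epsilon> by (intro order_tendstoD(2)) auto
    moreover have "hseq (1 / \<beta>) \<longlonglongrightarrow> 0"
      using hseq_in_null_seqs \<beta> by (simp add: null_seqs_def)
    then have "eventually (\<lambda>k. hseq (1 / \<beta>) k < \<delta>) sequentially"
      using \<delta> by (rule order_tendstoD)
    ultimately have "eventually (\<lambda>k. k \<ge> 1 \<and> real k powr (- p) * Z < \<epsilon> \<and> hseq (1 / \<beta>) k < \<delta>)
        sequentially"
      using eventually_ge_at_top[of 1] by eventually_elim auto
    then obtain k where
      k: "k \<ge> 1" "real k powr (- p) * Z < \<epsilon>" "hseq (1 / \<beta>) k < \<delta>"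
      by (auto dest: eventually_happens)
    have "dilate (hseq (1 / \<beta>)) k \<in> dilates (hseq (1 / \<beta>))"
      using k(1) by (auto simp: dilates_def)
    then obtain A where A: "\<forall>n\<ge>1. A n \<subseteq> X" "E \<subseteq> (\<Union>n\<in>{1..}. A n)"
      "\<forall>n\<ge>1. ediam d (A n) < ennreal (hseq (1 / \<beta>) (k * n))"
      using dom[unfolded dominated_def, rule_format, of "dilate (hseq (1 / \<beta>)) k"]
      by (auto simp: dilate_def)
    \<comment> \<open>Subordinate covers are numbered from 1, those of the premeasure from 0.\<close>
    define B where "B = (\<lambda>n. A (Suc n))"
    have diamB: "ediam d (B n) < ennreal (hseq (1 / \<beta>) (k * Suc n))" for n
      using A(3)[rule_format, of "Suc n"] by (simp add: B_def)
    have "B n \<subseteq> X" for n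
      using A(1) by (simp add: B_def)
    moreover have "ediam d (B n) \<le> ennreal \<delta>" for n
    proof -
      have "hseq (1 / \<beta>) (k * Suc n) \<le> hseq (1 / \<beta>) k"
        unfolding hseq_def using \<beta> by (auto intro: powr_mono2')
      then have "ennreal (hseq (1 / \<beta>) (k * Suc n)) \<le> ennreal \<delta>"
        using k(3) by (intro ennreal_leI) simp
      then show ?thesis
        using diamB[of n] by simp
    qed
    moreover have "E \<subseteq> (\<Union>n. B n)"
    proof
      fix x assume "x \<in> E"
      then obtain n where "n \<ge> 1" "x \<in> A n"
        using A(2) by auto
      then have "x \<in> B (n - 1)"
        by (simp add: B_def)
      then show "x \<in> (\<Union>n. B n)"
        by blast
    qed
    ultimately have "hausdorff_premeasure X d \<gamma> \<delta> E \<le>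
        (\<Sum>n. ennreal (enn2real (ediam d (B n)) powr \<gamma>))"
      unfolding hausdorff_premeasure_def by (intro Inf_lower) blast
    also have "\<dots> \<le> (\<Sum>n. ennreal (real k powr (- p) * real (Suc n) powr (- p)))"
    proof (rule suminf_le)
      fix n
      have "enn2real (ediam d (B n)) \<le> hseq (1 / \<beta>) (k * Suc n)"
        using diamB[of n] by (intro enn2real_leI) (auto simp: hseq_def)
      then have "enn2real (ediam d (B n)) powr \<gamma> \<le> hseq (1 / \<beta>) (k * Suc n) powr \<gamma>"
        using \<beta> by (intro powr_mono2) auto
      also have "\<dots> = (real (k * Suc n) + 1) powr (- p)"
        by (simp add: hseq_def powr_powr p_def)
      also have "\<dots> \<le> real (k * Suc n) powr (- p)"
        using k(1) p by (intro powr_mono2') (auto simp del: mult_Suc_right)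
      also have "\<dots> = real k powr (- p) * real (Suc n) powr (- p)"
        by (simp only: of_nat_mult powr_mult of_nat_0_le_iff)
      finally show "ennreal (enn2real (ediam d (B n)) powr \<gamma>)
          \<le> ennreal (real k powr (- p) * real (Suc n) powr (- p))"
        by (rule ennreal_leI)
    qed auto
    also have "\<dots> = ennreal (real k powr (- p) * Z)"
      unfolding Z_def suminf_mult[OF smZ, symmetric]
      using smZ by (intro suminf_ennreal2 summable_mult) auto
    also have "\<dots> \<le> ennreal \<epsilon>"
      using k(2) by (intro ennreal_leI) simp
    finally show ?thesis
      by simp
  qed
  then have "hausdorff_premeasure X d \<gamma> \<delta> E \<le> 0" if "\<delta> > 0" for \<delta>
    by (rule ennreal_le_epsilon) (use that in blast)
  then have "hausdorff_measure X d \<gamma> E \<le> 0"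
    unfolding hausdorff_measure_def by (intro SUP_least) simp
  then show ?thesis
    by simp
qed

theorem corollary7p2:
  fixes X :: "'a set" and d :: "'a \<Rightarrow> 'a \<Rightarrow> real" and E :: "'a set"
  assumes "Metric_space X d"
    and "separable_space (Metric_space.mtopology X d)"
    and "E \<subseteq> X"
  shows "hausdorff_dim X d E =
    (INF \<beta>\<in>{\<beta>. \<beta> > 0 \<and> dominated X d (dilates (hseq (1 / \<beta>))) E}. ennreal \<beta>)"
proof (rule antisym)
  show "hausdorff_dim X d E \<le>
      (INF \<beta>\<in>{\<beta>. \<beta> > 0 \<and> dominated X d (dilates (hseq (1 / \<beta>))) E}. ennreal \<beta>)"
  proof (rule INF_greatest)
    fix \<beta> assume "\<beta> \<in> {\<beta>. \<beta> > 0 \<and> dominated X d (dilates (hseq (1 / \<beta>))) E}"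
    then have \<beta>: "\<beta> > 0" "dominated X d (dilates (hseq (1 / \<beta>))) E"
      by auto
    show "hausdorff_dim X d E \<le> ennreal \<beta>"
    proof (rule ennreal_le_epsilon)
      fix e :: real assume e: "e > 0"
      then have "hausdorff_measure X d (\<beta> + e) E = 0"
        using \<beta> by (intro hausdorff_measure_zero_if_dominated) auto
      then have "hausdorff_dim X d E \<le> ennreal (\<beta> + e)"
        unfolding hausdorff_dim_def using \<beta>(1) e by (intro INF_lower) auto
      then show "hausdorff_dim X d E \<le> ennreal \<beta> + ennreal e"
        using \<beta>(1) e by simp
    qed
  qed
  show "(INF \<beta>\<in>{\<beta>. \<beta> > 0 \<and> dominated X d (dilates (hseq (1 / \<beta>))) E}. ennreal \<beta>)
      \<le> hausdorff_dim X d E"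
    unfolding hausdorff_dim_def
    by (rule INF_superset_mono) (auto intro: dominated_if_hausdorff_measure_zero)
qed

end
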